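(* For every positive integer $n$, the Birkhoff polytope $B_n$ has no separating hyperplane.
   Context: The Birkhoff polytope $B_n\subset\mathbb{R}^{n\times n}\cong\mathbb{R}^{n^2}$ is the set of all $n\times n$ doubly stochastic matrices (nonnegative real matrices with all row sums and column sums equal to $1$); equivalently, the convex hull of the $n!$ permutation matrices. For a convex polytope $\mathcal{P}$ and a hyperplane $\mathcal{H}$ with closed half-spaces $\mathcal{H}^{(+)},\mathcal{H}^{(-)}$ ($\mathcal{H}^{(+)}\cap\mathcal{H}^{(-)}=\mathcal{H}$), $\mathcal{H}$ is a separating hyperplane of $\mathcal{P}$ if $\mathcal{H}$ meets the relative interior of $\mathcal{P}$ and every vertex of each of $\mathcal{P}\cap\mathcal{H}^{(+)}$ and $\mathcal{P}\cap\mathcal{H}^{(-)}$ is a vertex of $\mathcal{P}$.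
   Formalization: A separating hyperplane is additionally required not to contain the polytope; without this, any hyperplane containing $B_n$ (e.g. first row sum equal to 1) would satisfy the stated definition and the claim would be false. *)

theory Defs
  imports "HOL-Analysis.Analysis"
begin

definition birkhoff_polytope :: "(real ^ 'n ^ 'n) set" where
  "birkhoff_polytope =
     {A. (\<forall>i j. 0 \<le> A $ i $ j) \<and>
         (\<forall>i. (\<Sum>j\<in>UNIV. A $ i $ j) = 1) \<and>
         (\<forall>j. (\<Sum>i\<in>UNIV. A $ i $ j) = 1)}"

text \<open>
  The vertices of a polytope are its extreme points. A separating hyperplane is understood to cut
  \<open>P\<close>, i.e. it does not contain \<open>P\<close>. Without this (usually tacit) requirement, any hyperplane
  containing a nonempty polytope \<open>P\<close> that is not full-dimensional would qualify: it
  meets the relative interior, and both halves are \<open>P\<close> itself. For the Birkhoff polytope, the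
  hyperplane on which the first row sum equals 1 would be an example.
\<close>

definition separating_hyperplane :: "'a::euclidean_space set \<Rightarrow> 'a set \<Rightarrow> bool" where
  "separating_hyperplane P H \<longleftrightarrow>
     (\<exists>a b. a \<noteq> 0 \<and> H = {x. a \<bullet> x = b} \<and>
        H \<inter> rel_interior P \<noteq> {} \<and> \<not> P \<subseteq> H \<and>
        (\<forall>v. v extreme_point_of (P \<inter> {x. a \<bullet> x \<ge> b}) \<longrightarrow> v extreme_point_of P) \<and>
        (\<forall>v. v extreme_point_of (P \<inter> {x. a \<bullet> x \<le> b}) \<longrightarrow> v extreme_point_of P))"

end

theory Submission imports Defs begin

text \<open>
  A separating hyperplane cannot cut an edge of the polytope in its relative interior, since the
  intersection point would be a new vertex of a half. Two permutation matrices \<open>\<sigma>\<close>, \<open>\<tau>\<close> span an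
  edge iff \<open>inv \<sigma> \<circ> \<tau>\<close> is a single cycle. Let \<open>f = (\<bullet>) a - b\<close> define the hyperplane and choose
  permutations with \<open>f \<sigma> > 0 > f \<tau>\<close> that differ in as few places as possible. By minimality, every
  permutation obtained from \<open>\<sigma>\<close> by switching some but not all of the cycles of \<open>inv \<sigma> \<circ> \<tau>\<close> lies
  on the hyperplane; as \<open>f\<close> is affine, there are exactly two cycles, with supports \<open>A\<close> and \<open>B\<close>, and
  \<open>f \<tau> = - f \<sigma>\<close>. For \<open>p \<in> A\<close> and \<open>q \<in> B\<close>, composing \<open>\<sigma>\<close> (or \<open>\<tau>\<close>) with the transposition of
  \<open>p\<close> and \<open>q\<close> gives a permutation adjacent to both \<open>\<sigma>\<close> and \<open>\<tau>\<close>, hence on the hyperplane.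
  Summing these relations over \<open>A \<times> B\<close>, the entries of \<open>a\<close> off the two cycles cancel and
  \<open>2 |A| |B| = |A| + |B|\<close> remains, which is impossible for \<open>|A|, |B| \<ge> 2\<close>.
\<close>

section \<open>Systems of distinct representatives\<close>

text \<open>Halmos-Vaughan induction on \<open>card I\<close>. If a nonempty proper subfamily is
  tight, it is matched within its own neighbours and the rest outside them. Otherwise every nonempty
  proper subfamily has slack, and one choice can be fixed freely.\<close>

theorem Hall_distinct_representatives:
  fixes N :: "'a \<Rightarrow> 'b set"
  assumes "finite I" and "\<And>i. i \<in> I \<Longrightarrow> finite (N i)"
    and "\<And>J. J \<subseteq> I \<Longrightarrow> card J \<le> card (\<Union>i\<in>J. N i)"
  shows "\<exists>f. inj_on f I \<and> (\<forall>i\<in>I. f i \<in> N i)"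
  using assms
proof (induction "card I" arbitrary: I N rule: less_induct)
  case less
  note finI = less.prems(1) and finN = less.prems(2) and hall = less.prems(3)
  show ?case
  proof (cases "\<exists>J. J \<subset> I \<and> J \<noteq> {} \<and> card J = card (\<Union>i\<in>J. N i)")
    case True
    then obtain J where J: "J \<subset> I" "J \<noteq> {}" "card J = card (\<Union>i\<in>J. N i)"
      by blast
    define M where "M = (\<Union>i\<in>J. N i)"
    have finJ: "finite J"
      using J(1) finI by (meson finite_subset psubset_imp_subset)
    then have finM: "finite M"
      using J(1) finN unfolding M_def by auto
    have "card J < card I"
      using J(1) finI by (rule psubset_card_mono[rotated])
    then obtain f where f: "inj_on f J" "\<forall>i\<in>J. f i \<in> N i"
      using less.hyps[of J N] finJ finN hall J(1) by (meson psubset_imp_subset subset_trans subsetD)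
    have "card (I - J) < card I"
      using J finI by (intro psubset_card_mono) auto
    \<comment> \<open>Hall's inequality for \<open>K \<union> J\<close>, minus the tight equality
      for \<open>J\<close>.\<close>
    moreover have "card K \<le> card (\<Union>i\<in>K. N i - M)" if K: "K \<subseteq> I - J" for K
    proof -
      have finK: "finite K"
        using K finI finite_subset by blast
      have finU: "finite (\<Union>i\<in>K. N i - M)"
        using finK K finN by auto
      have "card K + card J = card (K \<union> J)"
        using K finK finJ by (subst card_Un_disjoint) auto
      also have "\<dots> \<le> card (\<Union>i\<in>K \<union> J. N i)"
        using K J(1) by (intro hall) auto
      also have "(\<Union>i\<in>K \<union> J. N i) = (\<Union>i\<in>K. N i - M) \<union> M"
        unfolding M_def by auto
      also have "card \<dots> = card (\<Union>i\<in>K. N i - M) + card M"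
        using finU finM by (subst card_Un_disjoint) auto
      finally show ?thesis
        using J(3) unfolding M_def by simp
    qed
    ultimately obtain g where g: "inj_on g (I - J)" "\<forall>i\<in>I - J. g i \<in> N i - M"
      using less.hyps[of "I - J" "\<lambda>i. N i - M"] finI finN by auto
    define h where "h i = (if i \<in> J then f i else g i)" for i
    have "inj_on h I"
    proof (rule inj_onI)
      fix i j assume ij: "i \<in> I" "j \<in> I" "h i = h j"
      have "f k \<in> M" if "k \<in> J" for k
        using f(2) that unfolding M_def by blast
      moreover have "g k \<notin> M" if "k \<in> I - J" for k
        using g(2) that by blast
      ultimately have "i \<in> J \<longleftrightarrow> j \<in> J"
        using ij unfolding h_def by (metis DiffI)
      then show "i = j"
        using ij inj_onD[OF f(1)] inj_onD[OF g(1)] unfolding h_def by (cases "i \<in> J") auto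
    qed
    moreover have "\<forall>i\<in>I. h i \<in> N i"
      using f(2) g(2) unfolding h_def by auto
    ultimately show ?thesis
      by blast
  next
    case False
    show ?thesis
    proof (cases "I = {}")
      case True
      then show ?thesis by simp
    next
      case ne: False
      then obtain i where i: "i \<in> I"
        by blast
      have "card {i} \<le> card (\<Union>k\<in>{i}. N k)"
        using i by (intro hall) auto
      then obtain y where y: "y \<in> N i"
        by fastforce
      have "card (I - {i}) < card I"
        using finI i by (rule card_Diff1_less)
      \<comment> \<open>The slack of at least one element pays for the removal of
        \<open>y\<close>.\<close>
      moreover have "card K \<le> card (\<Union>k\<in>K. N k - {y})" if K: "K \<subseteq> I - {i}" for K
      proof (cases "K = {}")
        case nonempty: False
        have "K \<subset> I"
          using K i by auto
        then have "card K < card (\<Union>k\<in>K. N k)"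
          using False nonempty hall[of K] by (metis le_neq_implies_less psubset_imp_subset)
        moreover have "(\<Union>k\<in>K. N k - {y}) = (\<Union>k\<in>K. N k) - {y}"
          by auto
        moreover have "finite (\<Union>k\<in>K. N k)"
          using K finI finN by (auto intro: finite_subset)
        ultimately show ?thesis
          by (cases "y \<in> (\<Union>k\<in>K. N k)") (simp_all add: card_Diff_singleton_if)
      qed simp
      ultimately obtain g where g: "inj_on g (I - {i})" "\<forall>k\<in>I - {i}. g k \<in> N k - {y}"
        using less.hyps[of "I - {i}" "\<lambda>k. N k - {y}"] finI finN by auto
      have "inj_on (g(i := y)) I"
        using g unfolding inj_on_def by auto
      moreover have "\<forall>k\<in>I. (g(i := y)) k \<in> N k"
        using g(2) y by auto
      ultimately show ?thesis
        by blast
    qed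
  qed
qed

section \<open>Vertices of the Birkhoff polytope\<close>

definition permutation_matrix :: "('n::finite \<Rightarrow> 'n) \<Rightarrow> real ^ 'n ^ 'n" where
  "permutation_matrix \<sigma> = (\<chi> i j. if j = \<sigma> i then 1 else 0)"

lemma permutation_matrix_nth [simp]:
  "permutation_matrix \<sigma> $ i $ j = (if j = \<sigma> i then 1 else 0)"
  by (simp add: permutation_matrix_def)

lemma inner_permutation_matrix: "a \<bullet> permutation_matrix \<sigma> = (\<Sum>i\<in>UNIV. a $ i $ \<sigma> i)"
  by (simp add: inner_vec_def if_distrib cong: if_cong)

lemma sum_permutation_matrix_column:
  assumes "bij \<sigma>"
  shows "(\<Sum>i\<in>UNIV. permutation_matrix \<sigma> $ i $ j) = 1"
proof -
  have "(\<Sum>i\<in>UNIV. permutation_matrix \<sigma> $ i $ j) = (\<Sum>i\<in>UNIV. if i = inv \<sigma> j then 1 else 0)"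
    using assms by (intro sum.cong) (auto simp: bij_inv_eq_iff bij_is_inj bij_is_surj surj_f_inv_f)
  then show ?thesis
    by simp
qed

lemma permutation_matrix_in_birkhoff_polytope:
  "bij \<sigma> \<Longrightarrow> permutation_matrix \<sigma> \<in> birkhoff_polytope"
  using sum_permutation_matrix_column[of \<sigma>] by (simp add: birkhoff_polytope_def)

lemma convex_birkhoff_polytope: "convex (birkhoff_polytope :: (real ^ 'n::finite ^ 'n) set)"
  unfolding convex_def birkhoff_polytope_def
  by (auto simp: sum.distrib simp flip: sum_distrib_left)

lemma birkhoff_polytope_le_1:
  assumes "A \<in> birkhoff_polytope"
  shows "A $ i $ j \<le> 1"
proof -
  have "A $ i $ j \<le> (\<Sum>j\<in>UNIV. A $ i $ j)"
    using assms by (intro member_le_sum) (auto simp: birkhoff_polytope_def)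
  then show ?thesis
    using assms by (simp add: birkhoff_polytope_def)
qed

lemma compact_birkhoff_polytope: "compact (birkhoff_polytope :: (real ^ 'n::finite ^ 'n) set)"
proof -
  have "closed (birkhoff_polytope :: (real ^ 'n ^ 'n) set)"
    unfolding birkhoff_polytope_def
    by (intro closed_Collect_conj closed_Collect_all closed_Collect_le closed_Collect_eq
        continuous_intros)
  moreover have "norm A \<le> real CARD('n) * real CARD('n)"
    if A: "A \<in> birkhoff_polytope" for A :: "real ^ 'n ^ 'n"
  proof -
    have "norm (A $ i) \<le> real CARD('n)" for i
    proof -
      have "norm (A $ i) \<le> (\<Sum>j\<in>UNIV. \<bar>A $ i $ j\<bar>)"
        unfolding norm_vec_def real_norm_def by (rule L2_set_le_sum) simp
      also have "\<dots> \<le> (\<Sum>j\<in>(UNIV::'n set). 1)"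
        using A birkhoff_polytope_le_1[OF A]
        by (intro sum_mono) (auto simp: birkhoff_polytope_def)
      finally show ?thesis by simp
    qed
    then have "(\<Sum>i\<in>UNIV. norm (A $ i)) \<le> (\<Sum>i\<in>(UNIV::'n set). real CARD('n))"
      by (intro sum_mono)
    moreover have "norm A \<le> (\<Sum>i\<in>UNIV. norm (A $ i))"
      unfolding norm_vec_def by (rule L2_set_le_sum) simp
    ultimately show ?thesis
      by simp
  qed
  then have "bounded (birkhoff_polytope :: (real ^ 'n ^ 'n) set)"
    by (auto simp: bounded_iff)
  ultimately show ?thesis
    by (simp add: compact_eq_bounded_closed)
qed

text \<open>Double counting gives Hall's condition: the rows in \<open>J\<close> carry total mass
  \<open>card J\<close>, all of it in the columns that they support, and each column holds at most
  1.\<close>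

lemma birkhoff_polytope_support_contains_permutation:
  fixes A :: "real ^ 'n::finite ^ 'n"
  assumes A: "A \<in> birkhoff_polytope"
  shows "\<exists>\<sigma>. bij \<sigma> \<and> (\<forall>i. 0 < A $ i $ \<sigma> i)"
proof -
  have nonneg: "0 \<le> A $ i $ j" for i j
    using A by (simp add: birkhoff_polytope_def)
  define N where "N i = {j. 0 < A $ i $ j}" for i
  have "card J \<le> card (\<Union>i\<in>J. N i)" for J
  proof -
    let ?M = "\<Union>i\<in>J. N i"
    have "real (card J) = (\<Sum>i\<in>J. \<Sum>j\<in>UNIV. A $ i $ j)"
      using A by (simp add: birkhoff_polytope_def)
    also have "\<dots> = (\<Sum>i\<in>J. \<Sum>j\<in>?M. A $ i $ j)"
      using nonneg by (intro sum.cong sum.mono_neutral_right) (auto simp: N_def not_less intro: antisym)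
    also have "\<dots> = (\<Sum>j\<in>?M. \<Sum>i\<in>J. A $ i $ j)"
      by (rule sum.swap)
    also have "\<dots> \<le> (\<Sum>j\<in>?M. \<Sum>i\<in>UNIV. A $ i $ j)"
      using nonneg by (intro sum_mono sum_mono2) auto
    also have "\<dots> = real (card ?M)"
      using A by (simp add: birkhoff_polytope_def)
    finally show ?thesis by simp
  qed
  then obtain \<sigma> where "inj \<sigma>" "\<forall>i. \<sigma> i \<in> N i"
    using Hall_distinct_representatives[of UNIV N] by auto
  then show ?thesis
    by (auto simp: N_def bij_def finite_UNIV_inj_surj)
qed

text \<open>A small multiple of a permutation matrix within the support of \<open>A\<close> can be
  split off, and the rescaled remainder \<open>B\<close> is still doubly stochastic. Extremality
  then forces \<open>B\<close> to be that same permutation matrix.\<close>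

theorem extreme_point_of_birkhoff_polytope:
  fixes A :: "real ^ 'n::finite ^ 'n"
  assumes ext: "A extreme_point_of birkhoff_polytope"
  obtains \<sigma> where "bij \<sigma>" "A = permutation_matrix \<sigma>"
proof -
  have A: "A \<in> birkhoff_polytope"
    using ext by (simp add: extreme_point_of_def)
  have nonneg: "0 \<le> A $ i $ j" for i j
    using A by (simp add: birkhoff_polytope_def)
  obtain \<sigma> where \<sigma>: "bij \<sigma>" "\<And>i. 0 < A $ i $ \<sigma> i"
    using birkhoff_polytope_support_contains_permutation[OF A] by blast
  \<comment> \<open>Entries are at most 1, so halving the minimum gives \<open>e \<le> 1/2\<close>
    and makes the division by \<open>1 - e\<close> legitimate.\<close>
  define e where "e = Min (range (\<lambda>i. A $ i $ \<sigma> i)) / 2"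
  have e_le: "2 * e \<le> A $ i $ \<sigma> i" for i
    unfolding e_def by simp
  have e: "0 < e"
    unfolding e_def using \<sigma>(2) by simp
  have e1: "e < 1"
    using e_le[of undefined] birkhoff_polytope_le_1[OF A, of undefined "\<sigma> undefined"] e by linarith
  define B where "B = (1 / (1 - e)) *\<^sub>R (A - e *\<^sub>R permutation_matrix \<sigma>)"
  have B_nth: "B $ i $ j = (A $ i $ j - e * permutation_matrix \<sigma> $ i $ j) / (1 - e)" for i j
    by (simp add: B_def)
  have "B \<in> birkhoff_polytope"
  proof -
    have "0 \<le> B $ i $ j" for i j
      using e_le[of i] e e1 nonneg[of i j] by (simp add: B_nth)
    moreover have "(\<Sum>j\<in>UNIV. B $ i $ j) = 1" for i
    proof -
      have "(\<Sum>j\<in>UNIV. B $ i $ j) =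
          ((\<Sum>j\<in>UNIV. A $ i $ j) - e * (\<Sum>j\<in>UNIV. permutation_matrix \<sigma> $ i $ j)) / (1 - e)"
        unfolding B_nth sum_divide_distrib[symmetric] sum_subtractf sum_distrib_left ..
      then show ?thesis
        using A e1 by (simp add: birkhoff_polytope_def)
    qed
    moreover have "(\<Sum>i\<in>UNIV. B $ i $ j) = 1" for j
    proof -
      have "(\<Sum>i\<in>UNIV. B $ i $ j) =
          ((\<Sum>i\<in>UNIV. A $ i $ j) - e * (\<Sum>i\<in>UNIV. permutation_matrix \<sigma> $ i $ j)) / (1 - e)"
        unfolding B_nth sum_divide_distrib[symmetric] sum_subtractf sum_distrib_left ..
      then show ?thesis
        using A e1 unfolding sum_permutation_matrix_column[OF \<sigma>(1)]
        by (simp add: birkhoff_polytope_def)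
    qed
    ultimately show ?thesis
      by (simp add: birkhoff_polytope_def)
  qed
  moreover have A_eq: "A = (1 - e) *\<^sub>R B + e *\<^sub>R permutation_matrix \<sigma>"
    using e1 by (simp add: B_def)
  ultimately have "B = permutation_matrix \<sigma>"
    using ext permutation_matrix_in_birkhoff_polytope[OF \<sigma>(1)] e e1
    unfolding extreme_point_of_def in_segment by metis
  then have "A = permutation_matrix \<sigma>"
    using A_eq by (simp flip: scaleR_add_left)
  then show thesis
    using \<sigma>(1) that by blast
qed

section \<open>Edges of the Birkhoff polytope\<close>

text \<open>
  Equivalently, \<open>inv \<sigma> \<circ> \<tau>\<close> has at most one nontrivial cycle: the sets \<open>S\<close> below are the
  invariant sets of that permutation. Hence adjacent permutations span an edge or a vertex.
\<close>
definition adjacent_permutations :: "('n \<Rightarrow> 'n) \<Rightarrow> ('n \<Rightarrow> 'n) \<Rightarrow> bool" where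
  "adjacent_permutations \<sigma> \<tau> \<longleftrightarrow>
     (\<forall>S. \<sigma> ` S = \<tau> ` S \<longrightarrow> (\<forall>i\<in>S. \<sigma> i = \<tau> i) \<or> (\<forall>i. i \<notin> S \<longrightarrow> \<sigma> i = \<tau> i))"

lemma adjacent_permutations_sym: "adjacent_permutations \<sigma> \<tau> \<Longrightarrow> adjacent_permutations \<tau> \<sigma>"
  unfolding adjacent_permutations_def by metis

text \<open>Row and column sums leave one free parameter per nontrivial cycle of
  \<open>inv \<sigma> \<circ> \<tau>\<close>, and adjacency allows at most one such cycle.\<close>

lemma birkhoff_polytope_supported_on_adjacent:
  fixes Y :: "real ^ 'n::finite ^ 'n"
  assumes Y: "Y \<in> birkhoff_polytope" and bij: "bij \<sigma>" "bij \<tau>"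
    and adj: "adjacent_permutations \<sigma> \<tau>"
    and supp: "\<And>i j. j \<noteq> \<sigma> i \<Longrightarrow> j \<noteq> \<tau> i \<Longrightarrow> Y $ i $ j = 0"
  obtains s where "Y = (1 - s) *\<^sub>R permutation_matrix \<sigma> + s *\<^sub>R permutation_matrix \<tau>"
proof -
  have row: "Y $ i $ \<sigma> i + Y $ i $ \<tau> i = 1" if "\<sigma> i \<noteq> \<tau> i" for i
  proof -
    have "(\<Sum>j\<in>UNIV. Y $ i $ j) = (\<Sum>j\<in>{\<sigma> i, \<tau> i}. Y $ i $ j)"
      using supp by (intro sum.mono_neutral_right) auto
    then show ?thesis
      using Y that by (simp add: birkhoff_polytope_def)
  qed
  have row_eq: "Y $ i $ \<sigma> i = 1" if "\<sigma> i = \<tau> i" for i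
  proof -
    have "(\<Sum>j\<in>UNIV. Y $ i $ j) = (\<Sum>j\<in>{\<sigma> i}. Y $ i $ j)"
      using supp that by (intro sum.mono_neutral_right) auto
    then show ?thesis
      using Y by (simp add: birkhoff_polytope_def)
  qed
  have column: "Y $ i $ \<tau> i + Y $ k $ \<sigma> k = 1" if "\<sigma> k = \<tau> i" "\<sigma> i \<noteq> \<tau> i" for i k
  proof -
    have "(\<Sum>l\<in>UNIV. Y $ l $ \<tau> i) = (\<Sum>l\<in>{i, k}. Y $ l $ \<tau> i)"
    proof (intro sum.mono_neutral_right ballI)
      fix l assume "l \<in> UNIV - {i, k}"
      then have "\<tau> i \<noteq> \<tau> l" "\<tau> i \<noteq> \<sigma> l"
        using bij that(1) by (auto simp: bij_def dest: injD)
      then show "Y $ l $ \<tau> i = 0"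
        using supp by blast
    qed auto
    moreover have "i \<noteq> k"
      using that by auto
    ultimately show ?thesis
      using Y that by (simp add: birkhoff_polytope_def)
  qed
  show thesis
  proof (cases "\<exists>i. \<sigma> i \<noteq> \<tau> i")
    case True
    then obtain i0 where i0: "\<sigma> i0 \<noteq> \<tau> i0" by blast
    define s where "s = Y $ i0 $ \<tau> i0"
    \<comment> \<open>The value \<open>s\<close> propagates along the cycle of \<open>i0\<close>: if
      \<open>\<sigma> k = \<tau> i\<close>, then column \<open>\<tau> i\<close> and row
      \<open>k\<close> together give \<open>Y $ k $ \<tau> k = Y $ i $ \<tau> i\<close>. So
      \<open>S\<close> is invariant, and adjacency makes it contain every place where the
      permutations differ.\<close>
    define S where "S = {i. \<sigma> i \<noteq> \<tau> i \<and> Y $ i $ \<tau> i = s}"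
    have "\<tau> ` S \<subseteq> \<sigma> ` S"
    proof
      fix j assume "j \<in> \<tau> ` S"
      then obtain i where i: "i \<in> S" "j = \<tau> i" by blast
      obtain k where k: "\<sigma> k = \<tau> i"
        using bij(1) by (metis bij_pointE)
      have "\<sigma> k \<noteq> \<tau> k"
        using k i(1) bij unfolding S_def by (metis (mono_tags, lifting) bij_is_inj injD mem_Collect_eq)
      then have "k \<in> S"
        using row[of k] column[OF k] i(1) by (simp add: S_def)
      then show "j \<in> \<sigma> ` S"
        using i(2) k by (metis imageI)
    qed
    moreover have "card (\<tau> ` S) = card (\<sigma> ` S)"
      using bij by (metis bij_is_inj card_image inj_on_subset subset_UNIV)
    ultimately have "\<sigma> ` S = \<tau> ` S"
      by (metis card_subset_eq finite)
    moreover have "i0 \<in> S"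
      using i0 by (simp add: S_def s_def)
    ultimately have s: "Y $ i $ \<tau> i = s" if "\<sigma> i \<noteq> \<tau> i" for i
      using adj i0 that unfolding adjacent_permutations_def S_def by blast
    have "Y $ i $ j = ((1 - s) *\<^sub>R permutation_matrix \<sigma> + s *\<^sub>R permutation_matrix \<tau>) $ i $ j" for i j
      using s[of i] row[of i] row_eq[of i] supp[of j i] by (cases "\<sigma> i = \<tau> i") auto
    then show thesis
      using that by (metis vec_eq_iff)
  next
    case False
    have "Y $ i $ j = ((1 - 0) *\<^sub>R permutation_matrix \<sigma> + 0 *\<^sub>R permutation_matrix \<tau>) $ i $ j" for i j
      using False row_eq[of i] supp[of j i] by auto
    then show thesis
      using that by (metis vec_eq_iff)
  qed
qed

text \<open>The crossing point \<open>x\<close> of the edge and the hyperplane is a vertex of the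
  upper half: a segment of that half with \<open>x\<close> in its interior would have both ends on
  the line of the edge and on the hyperplane, hence both equal to \<open>x\<close>. Yet
  \<open>x\<close> is interior to the edge, so it is no vertex of the polytope.\<close>

lemma separating_hyperplane_not_cuts_edge:
  fixes a :: "real ^ 'n::finite ^ 'n"
  assumes ext: "\<And>v. v extreme_point_of (birkhoff_polytope \<inter> {x. a \<bullet> x \<ge> b}) \<Longrightarrow>
      v extreme_point_of birkhoff_polytope"
    and bij: "bij \<sigma>" "bij \<tau>" and adj: "adjacent_permutations \<sigma> \<tau>"
    and gt: "b < a \<bullet> permutation_matrix \<sigma>" and lt: "a \<bullet> permutation_matrix \<tau> < b"
  shows False
proof -
  let ?P = "permutation_matrix \<sigma>" and ?Q = "permutation_matrix \<tau>"
  define t where "t = (a \<bullet> ?P - b) / (a \<bullet> ?P - a \<bullet> ?Q)"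
  define x where "x = (1 - t) *\<^sub>R ?P + t *\<^sub>R ?Q"
  have t: "0 < t" "t < 1"
    using gt lt by (auto simp: t_def)
  have PQ: "?P \<in> birkhoff_polytope" "?Q \<in> birkhoff_polytope" "?P \<noteq> ?Q"
    using bij gt lt permutation_matrix_in_birkhoff_polytope by auto
  have param: "a \<bullet> ((1 - s) *\<^sub>R ?P + s *\<^sub>R ?Q) = b + (t - s) * (a \<bullet> ?P - a \<bullet> ?Q)" for s
  proof -
    have "t * (a \<bullet> ?P - a \<bullet> ?Q) = a \<bullet> ?P - b"
      using gt lt by (simp add: t_def)
    then show ?thesis
      by (simp add: inner_add_right left_diff_distrib right_diff_distrib)
  qed
  have ax: "a \<bullet> x = b"
    unfolding x_def param by simp
  have x: "x \<in> birkhoff_polytope"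
    unfolding x_def using PQ t convex_birkhoff_polytope by (intro convexD) auto
  have "x extreme_point_of (birkhoff_polytope \<inter> {x. a \<bullet> x \<ge> b})"
    unfolding extreme_point_of_def
  proof (intro conjI ballI notI)
    fix y z
    assume y: "y \<in> birkhoff_polytope \<inter> {x. a \<bullet> x \<ge> b}"
      and z: "z \<in> birkhoff_polytope \<inter> {x. a \<bullet> x \<ge> b}" and "x \<in> open_segment y z"
    then obtain u where u: "0 < u" "u < 1" "x = (1 - u) *\<^sub>R y + u *\<^sub>R z" and "y \<noteq> z"
      unfolding in_segment by blast
    \<comment> \<open>Nonnegative entries whose proper convex combination vanishes must vanish
      themselves; below, the same argument puts \<open>y\<close> and \<open>z\<close> on the
      hyperplane.\<close>
    have supp: "y $ i $ j = 0 \<and> z $ i $ j = 0" if "j \<noteq> \<sigma> i" "j \<noteq> \<tau> i" for i j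
    proof -
      have "(1 - u) * y $ i $ j + u * z $ i $ j = 0"
        using that arg_cong[OF u(3), of "\<lambda>M. M $ i $ j"] by (simp add: x_def)
      moreover have "0 \<le> (1 - u) * y $ i $ j" "0 \<le> u * z $ i $ j"
        using y z u by (auto simp: birkhoff_polytope_def)
      ultimately have "(1 - u) * y $ i $ j = 0" "u * z $ i $ j = 0"
        by linarith+
      then show ?thesis
        using u by simp
    qed
    obtain r where r: "y = (1 - r) *\<^sub>R ?P + r *\<^sub>R ?Q"
      using birkhoff_polytope_supported_on_adjacent[OF _ bij adj, of y] y supp by blast
    obtain s where s: "z = (1 - s) *\<^sub>R ?P + s *\<^sub>R ?Q"
      using birkhoff_polytope_supported_on_adjacent[OF _ bij adj, of z] z supp by blast
    have "(1 - u) * (a \<bullet> y - b) + u * (a \<bullet> z - b) = 0"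
      using ax u(3) by (simp add: inner_add_right algebra_simps)
    moreover have "0 \<le> (1 - u) * (a \<bullet> y - b)" "0 \<le> u * (a \<bullet> z - b)"
      using y z u by auto
    ultimately have "(1 - u) * (a \<bullet> y - b) = 0" "u * (a \<bullet> z - b) = 0"
      by linarith+
    then have "a \<bullet> y = b" "a \<bullet> z = b"
      using u by auto
    then have "r = t" "s = t"
      using gt lt unfolding r s param by auto
    then show False
      using r s \<open>y \<noteq> z\<close> by simp
  qed (use x ax in auto)
  then have "x extreme_point_of birkhoff_polytope"
    by (rule ext)
  moreover have "x \<in> open_segment ?P ?Q"
    unfolding in_segment x_def using t PQ by auto
  ultimately show False
    using PQ by (auto simp: extreme_point_of_def)
qed

section \<open>Linear functionals on permutations\<close>

lemma image_eq_Int: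
  assumes "inj \<sigma>" "inj \<tau>" "\<sigma> ` S = \<tau> ` S" "\<sigma> ` T = \<tau> ` T"
  shows "\<sigma> ` (S \<inter> T) = \<tau> ` (S \<inter> T)"
  using assms by (simp add: image_Int)

lemma image_eq_Diff:
  assumes "inj \<sigma>" "inj \<tau>" "\<sigma> ` S = \<tau> ` S" "\<sigma> ` T = \<tau> ` T"
  shows "\<sigma> ` (S - T) = \<tau> ` (S - T)"
  using assms by (simp add: image_set_diff)

text \<open>
  Here \<open>A\<close> and \<open>B\<close> are the only two nontrivial cycles of \<open>inv \<sigma> \<circ> \<tau>\<close>; a transposition that
  meets both of them merges them into one.
\<close>
lemma adjacent_permutations_transpose:
  fixes \<sigma> \<tau> :: "'n::finite \<Rightarrow> 'n"
  assumes inj: "inj \<sigma>" "inj \<tau>"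
    and A: "\<sigma> ` A = \<tau> ` A" "\<And>T. T \<subseteq> A \<Longrightarrow> \<sigma> ` T = \<tau> ` T \<Longrightarrow> T = {} \<or> T = A"
    and B: "\<sigma> ` B = \<tau> ` B" "\<And>T. T \<subseteq> B \<Longrightarrow> \<sigma> ` T = \<tau> ` T \<Longrightarrow> T = {} \<or> T = B"
    and disj: "A \<inter> B = {}" and D: "{i. \<sigma> i \<noteq> \<tau> i} = A \<union> B"
    and p: "p \<in> A" and q: "q \<in> B"
  shows "adjacent_permutations (\<sigma>(p := \<sigma> q, q := \<sigma> p)) \<tau>"
  unfolding adjacent_permutations_def
proof (intro allI impI)
  fix T
  define \<sigma>' where "\<sigma>' = \<sigma>(p := \<sigma> q, q := \<sigma> p)"
  assume "(\<sigma>(p := \<sigma> q, q := \<sigma> p)) ` T = \<tau> ` T"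
  then have T: "\<sigma>' ` T = \<tau> ` T"
    by (simp add: \<sigma>'_def)
  have pq: "p \<noteq> q"
    using p q disj by auto
  \<comment> \<open>On \<open>T\<close>, the swapped permutation has the same image as
    \<open>\<sigma>\<close> on \<open>T\<close> with \<open>x\<close> replaced by \<open>y\<close>.
    Inside the invariant set \<open>Y\<close> this would match \<open>T \<inter> Y\<close> with a
    set that has one more element.\<close>
  have no_split: "x \<in> T \<longrightarrow> y \<in> T"
    if xy: "x \<in> X" "y \<in> Y" "X \<inter> Y = {}" "\<sigma> ` Y = \<tau> ` Y" and \<sigma>': "\<sigma>' = \<sigma>(x := \<sigma> y, y := \<sigma> x)"
    for x y X Y
  proof (rule ccontr)
    assume "\<not> (x \<in> T \<longrightarrow> y \<in> T)"
    then have xT: "x \<in> T" "y \<notin> T" by auto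
    have "\<sigma>' ` T = \<sigma> ` (insert y (T - {x}))"
      using xT by (auto simp: \<sigma>' image_iff)
    then have "\<sigma> ` (insert y (T - {x}) \<inter> Y) = \<tau> ` (T \<inter> Y)"
      using T xy(4) inj by (simp add: image_Int)
    moreover have "insert y (T - {x}) \<inter> Y = insert y (T \<inter> Y)"
      using xy by auto
    ultimately have "card (\<sigma> ` insert y (T \<inter> Y)) = card (\<tau> ` (T \<inter> Y))"
      by simp
    then have "card (insert y (T \<inter> Y)) = card (T \<inter> Y)"
      using inj by (metis card_image inj_on_subset subset_UNIV)
    then show False
      using xT by simp
  qed
  have "p \<in> T \<longleftrightarrow> q \<in> T"
    using no_split[of p A q B] no_split[of q B p A] p q disj A(1) B(1) pq
    by (auto simp: \<sigma>'_def fun_upd_twist)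
  then have "\<sigma>' ` T = \<sigma> ` T"
    unfolding \<sigma>'_def by (auto simp: image_iff)
  then have "\<sigma> ` T = \<tau> ` T"
    using T by simp
  then have "T \<inter> A = {} \<or> T \<inter> A = A" "T \<inter> B = {} \<or> T \<inter> B = B"
    using A B image_eq_Int[OF inj] by auto
  then have "A \<union> B \<subseteq> T \<or> (A \<union> B) \<inter> T = {}"
    using \<open>p \<in> T \<longleftrightarrow> q \<in> T\<close> p q by auto
  then show "(\<forall>i\<in>T. (\<sigma>(p := \<sigma> q, q := \<sigma> p)) i = \<tau> i) \<or>
      (\<forall>i. i \<notin> T \<longrightarrow> (\<sigma>(p := \<sigma> q, q := \<sigma> p)) i = \<tau> i)"
    using D p q by auto
qed

lemma bij_swap_values:
  assumes "bij \<sigma>"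
  shows "bij (\<sigma>(p := \<sigma> q, q := \<sigma> p))"
proof -
  have "\<sigma>(p := \<sigma> q, q := \<sigma> p) = \<sigma> \<circ> id(p := q, q := p)"
    by auto
  moreover have "bij (id(p := q, q := p))"
    by (rule involuntory_imp_bij) auto
  ultimately show ?thesis
    using assms by (metis bij_comp)
qed

lemma sum_swap_values:
  fixes w :: "'n::finite \<Rightarrow> 'n \<Rightarrow> real"
  assumes "p \<noteq> q"
  shows "(\<Sum>i\<in>UNIV. w i ((\<sigma>(p := \<sigma> q, q := \<sigma> p)) i)) =
    (\<Sum>i\<in>UNIV. w i (\<sigma> i)) + (w p (\<sigma> q) + w q (\<sigma> p) - w p (\<sigma> p) - w q (\<sigma> q))"
proof -
  have split: "(\<Sum>i\<in>UNIV. g i) = g p + g q + (\<Sum>i\<in>UNIV - {p} - {q}. g i)" for g :: "'n \<Rightarrow> real"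
    using assms by (simp add: sum.remove[of UNIV p] sum.remove[of "UNIV - {p}" q])
  have "(\<Sum>i\<in>UNIV - {p} - {q}. w i ((\<sigma>(p := \<sigma> q, q := \<sigma> p)) i)) =
      (\<Sum>i\<in>UNIV - {p} - {q}. w i (\<sigma> i))"
    by (rule sum.cong) auto
  then show ?thesis
    using assms unfolding split by simp
qed

text \<open>\<open>S\<close> is a union of cycles of \<open>inv \<sigma> \<circ> \<tau>\<close>, so
  values taken on \<open>S\<close> and off \<open>S\<close> cannot collide. This is the switching of
  some of the cycles.\<close>

lemma bij_splice:
  fixes \<sigma> \<tau> :: "'n::finite \<Rightarrow> 'n"
  assumes bij: "bij \<sigma>" "bij \<tau>" and S: "\<sigma> ` S = \<tau> ` S"
  shows "bij (\<lambda>i. if i \<in> S then \<tau> i else \<sigma> i)"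
proof -
  have "inj (\<lambda>i. if i \<in> S then \<tau> i else \<sigma> i)"
  proof (rule injI)
    fix i j
    have "\<tau> k \<noteq> \<sigma> l" if "k \<in> S" "l \<notin> S" for k l
      using that S bij(1) by (metis bij_is_inj imageI inj_image_mem_iff)
    moreover assume "(if i \<in> S then \<tau> i else \<sigma> i) = (if j \<in> S then \<tau> j else \<sigma> j)"
    ultimately show "i = j"
      using bij by (auto simp: bij_def dest: injD split: if_splits) metis+
  qed
  then show ?thesis
    by (intro bijI finite_UNIV_inj_surj finite)
qed

text \<open>Connectedness of the edge graph is not enough: a path from above \<open>b\<close> to
  below may pass through permutations with value exactly \<open>b\<close>. Hence the argument by a
  closest pair.\<close>

theorem functional_cuts_adjacent_permutations:
  fixes w :: "'n::finite \<Rightarrow> 'n \<Rightarrow> real" and b :: real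
  defines "F \<equiv> \<lambda>\<sigma>. \<Sum>i\<in>UNIV. w i (\<sigma> i)"
  assumes "bij \<sigma>0" "bij \<tau>0" "b < F \<sigma>0" "F \<tau>0 < b"
  shows "\<exists>\<sigma> \<tau>. bij \<sigma> \<and> bij \<tau> \<and> adjacent_permutations \<sigma> \<tau> \<and> b < F \<sigma> \<and> F \<tau> < b"
proof (rule ccontr)
  assume "\<not> ?thesis"
  then have no_cut: "\<not> (b < F \<sigma> \<and> F \<tau> < b)"
    if "bij \<sigma>" "bij \<tau>" "adjacent_permutations \<sigma> \<tau>" for \<sigma> \<tau>
    using that by blast
  define cut where "cut = (\<lambda>(\<sigma>, \<tau>). bij \<sigma> \<and> bij \<tau> \<and> b < F \<sigma> \<and> F \<tau> < b)"
  define d where "d = (\<lambda>(\<sigma>, \<tau>). card {i :: 'n. \<sigma> i \<noteq> (\<tau> i :: 'n)})"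
  have "cut (\<sigma>0, \<tau>0)"
    using assms by (simp add: cut_def)
  then obtain \<sigma> \<tau> where "cut (\<sigma>, \<tau>)" and "\<And>\<rho> \<pi>. cut (\<rho>, \<pi>) \<Longrightarrow> d (\<sigma>, \<tau>) \<le> d (\<rho>, \<pi>)"
    using ex_has_least_nat[of cut _ d] by (metis surj_pair)
  then have bij: "bij \<sigma>" "bij \<tau>" and gt: "b < F \<sigma>" and lt: "F \<tau> < b"
    and minimal: "\<And>\<rho> \<pi>. bij \<rho> \<Longrightarrow> bij \<pi> \<Longrightarrow> b < F \<rho> \<Longrightarrow> F \<pi> < b \<Longrightarrow>
      card {i. \<sigma> i \<noteq> \<tau> i} \<le> card {i. \<rho> i \<noteq> \<pi> i}"
    by (auto simp: cut_def d_def)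
  have inj: "inj \<sigma>" "inj \<tau>"
    using bij by (auto simp: bij_is_inj)
  define D where "D = {i. \<sigma> i \<noteq> \<tau> i}"
  define u where "u = F \<sigma> - b"
  define g where "g i = w i (\<tau> i) - w i (\<sigma> i)" for i
  have u: "0 < u"
    using gt by (simp add: u_def)
  \<comment> \<open>Switching only the part of \<open>D\<close> in \<open>S\<close> gives
    \<open>m\<close>, closer to both \<open>\<sigma>\<close> and \<open>\<tau>\<close> than they are
    to each other. Minimality rules out \<open>F m < b\<close> through the pair with
    \<open>\<sigma>\<close>, and \<open>F m > b\<close> through the pair with
    \<open>\<tau>\<close>.\<close>
  have sum_g: "(\<Sum>i\<in>S. g i) = - u"
    if S: "\<sigma> ` S = \<tau> ` S" "D \<inter> S \<noteq> {}" "D - S \<noteq> {}" for S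
  proof -
    define m where "m i = (if i \<in> S then \<tau> i else \<sigma> i)" for i
    have m: "bij m"
      unfolding m_def using bij_splice[OF bij S(1)] .
    have "{i. \<sigma> i \<noteq> m i} \<subset> D" "{i. m i \<noteq> \<tau> i} \<subset> D"
      using S by (auto simp: m_def D_def)
    then have "card {i. \<sigma> i \<noteq> m i} < card D" "card {i. m i \<noteq> \<tau> i} < card D"
      by (simp_all add: psubset_card_mono)
    then have "F m = b"
      using minimal[OF bij(1) m gt] minimal[OF m bij(2) _ lt] by (fold D_def) linarith
    moreover have "F m - F \<sigma> = (\<Sum>i\<in>UNIV. if i \<in> S then g i else 0)"
      unfolding F_def sum_subtractf[symmetric] by (rule sum.cong) (auto simp: m_def g_def)
    moreover have "(\<Sum>i\<in>UNIV. if i \<in> S then g i else 0) = (\<Sum>i\<in>S. g i)"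
      by (subst sum.inter_restrict[symmetric]) auto
    ultimately show ?thesis
      by (simp add: u_def)
  qed
  obtain S where S: "\<sigma> ` S = \<tau> ` S" "D \<inter> S \<noteq> {}" "D - S \<noteq> {}"
    using no_cut[OF bij] gt lt unfolding adjacent_permutations_def D_def by blast
  have D_closed: "\<sigma> ` D = \<tau> ` D"
  proof -
    have "\<sigma> ` (- D) = \<tau> ` (- D)"
      by (rule image_cong) (auto simp: D_def)
    then show ?thesis
      using bij by (metis bij_image_Compl_eq double_complement)
  qed
  define A where "A = D \<inter> S"
  define B where "B = D - S"
  have AB: "A \<noteq> {}" "B \<noteq> {}" "A \<inter> B = {}" "D = A \<union> B"
    using S by (auto simp: A_def B_def)
  have A: "\<sigma> ` A = \<tau> ` A" and B: "\<sigma> ` B = \<tau> ` B"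
    unfolding A_def B_def
    using image_eq_Int[OF inj D_closed S(1)] image_eq_Diff[OF inj D_closed S(1)] by auto
  \<comment> \<open>Three disjoint pieces would contribute \<open>- u\<close> each, while two of them together also
    contribute only \<open>- u\<close>.\<close>
  have irreducible: "T = {} \<or> T = X"
    if X: "X \<subseteq> D" "X \<noteq> D" "\<sigma> ` X = \<tau> ` X" and T: "T \<subseteq> X" "\<sigma> ` T = \<tau> ` T" for X T
  proof (rule ccontr)
    assume ne: "\<not> (T = {} \<or> T = X)"
    have "(\<Sum>i\<in>X. g i) = (\<Sum>i\<in>X - T. g i) + (\<Sum>i\<in>T. g i)"
      using T(1) by (simp add: sum.subset_diff)
    moreover have "(\<Sum>i\<in>X. g i) = - u" "(\<Sum>i\<in>T. g i) = - u"
      using X T ne by (auto intro!: sum_g)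
    moreover have "(\<Sum>i\<in>X - T. g i) = - u"
      using X T ne image_eq_Diff[OF inj X(3) T(2)] by (intro sum_g) auto
    ultimately show False
      using u by simp
  qed
  have irr_A: "\<And>T. T \<subseteq> A \<Longrightarrow> \<sigma> ` T = \<tau> ` T \<Longrightarrow> T = {} \<or> T = A"
    and irr_B: "\<And>T. T \<subseteq> B \<Longrightarrow> \<sigma> ` T = \<tau> ` T \<Longrightarrow> T = {} \<or> T = B"
    using irreducible[of A] irreducible[of B] A B AB by blast+
  have sums: "(\<Sum>i\<in>A. g i) = - u" "(\<Sum>i\<in>B. g i) = - u"
    using A B AB by (auto intro!: sum_g)
  have "F \<tau> = b - u"
  proof -
    have "F \<tau> - F \<sigma> = (\<Sum>i\<in>UNIV. g i)"
      unfolding F_def sum_subtractf[symmetric] g_def ..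
    also have "\<dots> = (\<Sum>i\<in>D. g i)"
      by (rule sum.mono_neutral_right) (auto simp: D_def g_def)
    also have "\<dots> = - u - u"
      using sums AB by (simp add: sum.union_disjoint)
    finally show ?thesis
      by (simp add: u_def)
  qed
  \<comment> \<open>An invariant singleton is a point where \<open>\<sigma>\<close> and
    \<open>\<tau>\<close> agree, so it cannot lie in \<open>D\<close>.\<close>
  have two: "2 \<le> card X" if X: "X \<noteq> {}" "X \<subseteq> D" "\<sigma> ` X = \<tau> ` X" for X
  proof (rule ccontr)
    assume "\<not> 2 \<le> card X"
    moreover have "card X \<noteq> 0"
      using X by simp
    ultimately have "card X = 1"
      by linarith
    then obtain x where "X = {x}"
      by (rule card_1_singletonE)
    then show False
      using X by (auto simp: D_def)
  qed
  have card: "2 \<le> card A" "2 \<le> card B"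
    using two AB A B by auto
  \<comment> \<open>A transposition changes only two values, so a permutation and its swapped
    version are closer than the minimal pair.\<close>
  have card_D: "2 < card D"
    using card AB by (simp add: card_Un_disjoint)
  \<comment> \<open>Each swapped permutation has value exactly \<open>b\<close>. One inequality
    comes from its adjacency to the permutation on the other side, the opposite one from minimality,
    since it is close to the permutation it was made from.\<close>
  have swap: "w p (\<sigma> q) + w q (\<sigma> p) - w p (\<sigma> p) - w q (\<sigma> q) = - u"
    "w p (\<tau> q) + w q (\<tau> p) - w p (\<tau> p) - w q (\<tau> q) = u"
    if p: "p \<in> A" and q: "q \<in> B" for p q
  proof -
    have pq: "p \<noteq> q"
      using p q AB by auto
    let ?\<sigma> = "\<sigma>(p := \<sigma> q, q := \<sigma> p)" and ?\<tau> = "\<tau>(p := \<tau> q, q := \<tau> p)"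
    note bij' = bij_swap_values[OF bij(1), of p q] bij_swap_values[OF bij(2), of p q]
    have "adjacent_permutations ?\<sigma> \<tau>"
      using AB D_def p q
      by (intro adjacent_permutations_transpose[OF inj A irr_A B irr_B]) auto
    then have "F ?\<sigma> \<le> b"
      using no_cut[OF bij'(1) bij(2)] lt by auto
    have "adjacent_permutations ?\<tau> \<sigma>"
      using AB D_def p q A B irr_A irr_B inj
      by (intro adjacent_permutations_transpose[of \<tau> \<sigma> A B]) (auto simp: eq_commute)
    then have "b \<le> F ?\<tau>"
      using no_cut[OF bij(1) bij'(2)] gt adjacent_permutations_sym by force
    have "card {i. \<sigma> i \<noteq> ?\<sigma> i} \<le> card {p, q}" "card {i. ?\<tau> i \<noteq> \<tau> i} \<le> card {p, q}"
      by (rule card_mono; auto)+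
    then have "card {i. \<sigma> i \<noteq> ?\<sigma> i} < card D" "card {i. ?\<tau> i \<noteq> \<tau> i} < card D"
      using pq card_D by auto
    then have "b \<le> F ?\<sigma>" "F ?\<tau> \<le> b"
      using minimal[OF bij(1) bij'(1) gt] minimal[OF bij'(2) bij(2) _ lt] unfolding D_def
      by (meson not_le)+
    then have "F ?\<sigma> = b" "F ?\<tau> = b"
      using \<open>F ?\<sigma> \<le> b\<close> \<open>b \<le> F ?\<tau>\<close> by auto
    then show "w p (\<sigma> q) + w q (\<sigma> p) - w p (\<sigma> p) - w q (\<sigma> q) = - u"
      "w p (\<tau> q) + w q (\<tau> p) - w p (\<tau> p) - w q (\<tau> q) = u"
      using \<open>F \<tau> = b - u\<close> sum_swap_values[OF pq, of w \<sigma>] sum_swap_values[OF pq, of w \<tau>]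
      unfolding F_def u_def by linarith+
  qed
  have reindex: "(\<Sum>x\<in>X. h (\<sigma> x)) = (\<Sum>x\<in>X. h (\<tau> x))" if "\<sigma> ` X = \<tau> ` X"
    for X and h :: "'n \<Rightarrow> real"
    using that inj by (metis (no_types, lifting) inj_on_subset subset_UNIV sum.reindex_cong)
  \<comment> \<open>The mixed entries cancel after summation because \<open>\<sigma>\<close> and
    \<open>\<tau>\<close> have the same image on \<open>A\<close> and on \<open>B\<close>.\<close>
  have "(\<Sum>p\<in>A. \<Sum>q\<in>B. w p (\<sigma> q)) = (\<Sum>p\<in>A. \<Sum>q\<in>B. w p (\<tau> q))"
    by (intro sum.cong reindex B refl)
  moreover have "(\<Sum>p\<in>A. \<Sum>q\<in>B. w q (\<sigma> p)) = (\<Sum>p\<in>A. \<Sum>q\<in>B. w q (\<tau> p))"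
    unfolding sum.swap[of _ B A] by (intro sum.cong reindex A refl)
  ultimately have "(\<Sum>p\<in>A. \<Sum>q\<in>B. (w p (\<tau> q) + w q (\<tau> p)) - (w p (\<sigma> q) + w q (\<sigma> p))) = 0"
    by (simp add: sum.distrib sum_subtractf)
  \<comment> \<open>Termwise, this is the difference of the two identities in
    \<open>swap\<close>.\<close>
  moreover have "(\<Sum>p\<in>A. \<Sum>q\<in>B. (w p (\<tau> q) + w q (\<tau> p)) - (w p (\<sigma> q) + w q (\<sigma> p))) =
      (\<Sum>p\<in>A. \<Sum>q\<in>B. 2 * u + g p + g q)"
  proof (intro sum.cong refl)
    fix p q assume "p \<in> A" "q \<in> B"
    then show "(w p (\<tau> q) + w q (\<tau> p)) - (w p (\<sigma> q) + w q (\<sigma> p)) = 2 * u + g p + g q"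
      using swap[of p q] unfolding g_def by linarith
  qed
  moreover have "(\<Sum>p\<in>A. \<Sum>q\<in>B. 2 * u + g p + g q) =
      u * (2 * real (card A) * real (card B) - real (card A) - real (card B))"
  proof -
    have "(\<Sum>p\<in>A. \<Sum>q\<in>B. 2 * u + g p + g q) =
        real (card A) * (real (card B) * (2 * u)) + real (card B) * (\<Sum>p\<in>A. g p) +
        real (card A) * (\<Sum>q\<in>B. g q)"
      by (simp add: sum.distrib sum_distrib_left distrib_left)
    then show ?thesis
      unfolding sums by (simp add: algebra_simps)
  qed
  ultimately have "2 * real (card A) * real (card B) = real (card A) + real (card B)"
    using u by simp
  \<comment> \<open>Adding these bounds gives \<open>2 |A| |B| \<ge> 2 (|A| + |B|)\<close>, which
    exceeds \<open>|A| + |B|\<close>.\<close>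
  moreover have "2 * real (card B) \<le> real (card A) * real (card B)"
    "real (card A) * 2 \<le> real (card A) * real (card B)"
    using card by (auto intro!: mult_right_mono mult_left_mono)
  ultimately show False
    using card by linarith
qed

section \<open>Permutations on both sides of a cutting hyperplane\<close>

lemma birkhoff_polytope_permutation_above:
  fixes a :: "real ^ 'n::finite ^ 'n"
  assumes "x \<in> birkhoff_polytope" "b < a \<bullet> x"
  obtains \<sigma> where "bij \<sigma>" "b < a \<bullet> permutation_matrix \<sigma>"
proof -
  \<comment> \<open>If every vertex satisfied \<open>a \<bullet> v \<le> b\<close>, so would their
    convex hull, which by Krein-Milman is the whole polytope.\<close>
  have "\<exists>v. v extreme_point_of (birkhoff_polytope :: (real ^ 'n ^ 'n) set) \<and> b < a \<bullet> v"
  proof (rule ccontr)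
    assume "\<not> ?thesis"
    then have "{v. v extreme_point_of (birkhoff_polytope :: (real ^ 'n ^ 'n) set)} \<subseteq> {v. a \<bullet> v \<le> b}"
      by auto
    then have "convex hull {v. v extreme_point_of (birkhoff_polytope :: (real ^ 'n ^ 'n) set)}
        \<subseteq> {v. a \<bullet> v \<le> b}"
      by (rule hull_minimal) (rule convex_halfspace_le)
    then show False
      using assms Krein_Milman_Minkowski[OF compact_birkhoff_polytope convex_birkhoff_polytope]
      by fastforce
  qed
  then show thesis
    using that extreme_point_of_birkhoff_polytope by metis
qed

theorem theorem3p3:
  "\<nexists>H. separating_hyperplane (birkhoff_polytope :: (real ^ 'n::finite ^ 'n) set) H"
proof
  let ?P = "birkhoff_polytope :: (real ^ 'n ^ 'n) set"
  assume "\<exists>H. separating_hyperplane ?P H"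
  then obtain a b where
    meets: "{x. a \<bullet> x = b} \<inter> rel_interior ?P \<noteq> {}" and proper: "\<not> ?P \<subseteq> {x. a \<bullet> x = b}" and
    ext: "\<And>v. v extreme_point_of (?P \<inter> {x. a \<bullet> x \<ge> b}) \<Longrightarrow> v extreme_point_of ?P"
    unfolding separating_hyperplane_def by blast
  obtain x where x: "x \<in> rel_interior ?P" "a \<bullet> x = b"
    using meets by blast
  obtain y where y: "y \<in> ?P" "a \<bullet> y \<noteq> b"
    using proper by blast
  \<comment> \<open>As \<open>x\<close> is in the relative interior, the segment from
    \<open>y\<close> can be prolonged beyond \<open>x\<close> inside the polytope; its new end
    \<open>z\<close> lies strictly on the other side of the hyperplane from
    \<open>y\<close>.\<close>
  obtain e where e: "1 < e" "(1 - e) *\<^sub>R y + e *\<^sub>R x \<in> ?P"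
    using convex_rel_interior_if[OF convex_birkhoff_polytope x(1)] y(1) rel_interior_subset hull_subset
    by (metis less_eq_real_def subsetD)
  define z where "z = (1 - e) *\<^sub>R y + e *\<^sub>R x"
  have z: "z \<in> ?P" "a \<bullet> z - b = (e - 1) * (b - a \<bullet> y)"
    using e x by (simp_all add: z_def inner_add_right algebra_simps)
  have "\<exists>y1\<in>?P. \<exists>y2\<in>?P. b < a \<bullet> y1 \<and> a \<bullet> y2 < b"
  proof (cases "a \<bullet> y < b")
    case True
    then have "0 < a \<bullet> z - b"
      unfolding z(2) using e by simp
    then show ?thesis
      using True y z by (meson diff_gt_0_iff_gt)
  next
    case False
    then have "a \<bullet> z - b < 0"
      unfolding z(2) using e y by (simp add: mult_pos_neg)
    then show ?thesis
      using False y z by (metis diff_less_0_iff_less linorder_neqE_linordered_idom)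
  qed
  \<comment> \<open>Negating \<open>a\<close> and \<open>b\<close> lets the same lemma provide a
    permutation below the hyperplane.\<close>
  then obtain y1 y2 where "y1 \<in> ?P" "y2 \<in> ?P" "b < a \<bullet> y1" "- b < (- a) \<bullet> y2"
    by auto
  then obtain \<sigma> \<tau> where "bij \<sigma>" "bij \<tau>"
    "b < a \<bullet> permutation_matrix \<sigma>" "- b < (- a) \<bullet> permutation_matrix \<tau>"
    using birkhoff_polytope_permutation_above by metis
  then have "bij \<sigma>" "bij \<tau>"
    "b < a \<bullet> permutation_matrix \<sigma>" "a \<bullet> permutation_matrix \<tau> < b"
    by simp_all
  then have "\<exists>\<sigma> \<tau>. bij \<sigma> \<and> bij \<tau> \<and> adjacent_permutations \<sigma> \<tau> \<and>
      b < a \<bullet> permutation_matrix \<sigma> \<and> a \<bullet> permutation_matrix \<tau> < b"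
    using functional_cuts_adjacent_permutations[of \<sigma> \<tau> b "\<lambda>i j. a $ i $ j"]
    by (simp add: inner_permutation_matrix)
  then show False
    using separating_hyperplane_not_cuts_edge[OF ext] by blast
qed

end
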